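(* Let $G\subseteq\binom{[n]}{2}$ be a simple loopless graph on $[n]$, let $\mathsf{Shi}(G)=\{x_i-x_j=0: 1\le i<j\le n\}\cup\{x_i-x_j=1: ij\in G\}$ in $\mathbb{R}^n$, and let $w\in\mathfrak{S}(n)$ with cone $wC=\{x\in\mathbb{R}^n: x_{w(1)}>x_{w(2)}>\cdots>x_{w(n)}\}$. Let $\Phi^+(G,w)$ be the set of hyperplanes $H_{ij}:\ x_{w(i)}-x_{w(j)}=1$ for positions $1\le i<j\le n$ with $w(i)<w(j)$ and $\{w(i),w(j)\}\in G$ (these are exactly the hyperplanes of $\mathsf{Shi}(G)$ not through the origin that meet $wC$), partially ordered by $H_{i'j'}\le H_{ij}$ if and only if $i\le i'<j'\le j$. Then the map sending a region $R$ of $\mathsf{Shi}(G)$ contained in $wC$ to the set of hyperplanes of $\mathsf{Shi}(G)$ that lie above $R$ is a bijection from the set of regions of $\mathsf{Shi}(G)$ contained in $wC$ to the set of order ideals (down-closed subsets) of $\Phi^+(G,w)$. Moreover, the maximal elements of the order ideal associated to $R$ are exactly the ceilings of $R$.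
   Context: Edges of $G$ are written $ij$ with $i<j$. Regions of an arrangement are the connected components of the complement of the union of its hyperplanes. A hyperplane $H$ not containing the origin lies above a region $R$ if $R$ and the origin lie in the same open half-space of $H$. A wall of $R$ is a hyperplane of the arrangement that is the affine span of a codimension-one face of the closure $\bar R$; a ceiling of $R$ is a wall that does not contain the origin and such that $R$ and the origin lie in the same half-space of it.
   Formalization: The map sends R to the hyperplanes of Φ⁺(G,w) (those meeting wC) that lie above R, not to all hyperplanes of Shi(G) above R; with all of them the claim fails, e.g. for n=2, G={12}, w=21, where x_1−x_2=1 lies above R=wC but Φ⁺(G,w) is empty. *)

theory Defs
  imports "HOL-Analysis.Analysis" "HOL-Combinatorics.Permutations"
begin

text \<open>The ground set \<open>[n]\<close> is the universe of a finite linearly ordered type \<open>'n\<close>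
  (with \<open>n = CARD('n)\<close>), which serves both for the values and for the positions of a
  permutation.  Hyperplanes and regions are subsets of \<open>real^'n\<close>.\<close>

definition diff_hyperplane :: "'n::finite \<Rightarrow> 'n \<Rightarrow> real \<Rightarrow> (real^'n) set" where
  "diff_hyperplane i j c = {x. x $ i - x $ j = c}"

definition Shi :: "'n set set \<Rightarrow> (real^'n::{finite,linorder}) set set" where
  "Shi G = {diff_hyperplane i j 0 | i j. i < j}
         \<union> {diff_hyperplane i j 1 | i j. i < j \<and> {i, j} \<in> G}"

definition regions :: "('a::euclidean_space) set set \<Rightarrow> 'a set set" where
  "regions \<A> = components (- \<Union>\<A>)"

text \<open>Both sides of \<open>H\<close> are covered, since \<open>(a, b)\<close> may be replaced by \<open>(-a, -b)\<close>.\<close>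

definition open_halfspaces :: "('a::euclidean_space) set \<Rightarrow> 'a set set" where
  "open_halfspaces H = {{x. a \<bullet> x < b} | a b. a \<noteq> 0 \<and> H = {x. a \<bullet> x = b}}"

definition lies_above :: "('a::euclidean_space) set \<Rightarrow> 'a set \<Rightarrow> bool" where
  "lies_above H R \<longleftrightarrow> 0 \<notin> H \<and> (\<exists>U \<in> open_halfspaces H. 0 \<in> U \<and> R \<subseteq> U)"

definition walls :: "('a::euclidean_space) set set \<Rightarrow> 'a set \<Rightarrow> 'a set set" where
  "walls \<A> R = {H \<in> \<A>. \<exists>F. F facet_of closure R \<and> affine hull F = H}"

definition ceilings :: "('a::euclidean_space) set set \<Rightarrow> 'a set \<Rightarrow> 'a set set" where
  "ceilings \<A> R = {H \<in> walls \<A> R. lies_above H R}"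

definition perm_cone :: "('n \<Rightarrow> 'n) \<Rightarrow> (real^'n::{finite,linorder}) set" where
  "perm_cone w = {x. \<forall>i j. i < j \<longrightarrow> x $ w i > x $ w j}"

definition pos_hyperplane ::
    "('n \<Rightarrow> 'n) \<Rightarrow> 'n \<Rightarrow> 'n \<Rightarrow> (real^'n::{finite,linorder}) set" where
  "pos_hyperplane w i j = diff_hyperplane (w i) (w j) 1"

definition Phi_plus ::
    "'n set set \<Rightarrow> ('n \<Rightarrow> 'n) \<Rightarrow> (real^'n::{finite,linorder}) set set" where
  "Phi_plus G w = {pos_hyperplane w i j | i j. i < j \<and> w i < w j \<and> {w i, w j} \<in> G}"

definition Phi_le ::
    "('n \<Rightarrow> 'n) \<Rightarrow> (real^'n::{finite,linorder}) set \<Rightarrow> (real^'n::{finite,linorder}) set \<Rightarrow> bool" where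
  "Phi_le w H' H \<longleftrightarrow> (\<exists>i' j' i j. H' = pos_hyperplane w i' j' \<and> H = pos_hyperplane w i j
      \<and> i \<le> i' \<and> i' < j' \<and> j' \<le> j)"

definition order_ideals :: "'b set \<Rightarrow> ('b \<Rightarrow> 'b \<Rightarrow> bool) \<Rightarrow> 'b set set" where
  "order_ideals P le = {I. I \<subseteq> P \<and> (\<forall>x\<in>I. \<forall>y\<in>P. le y x \<longrightarrow> y \<in> I)}"

definition maximal_elements :: "('b \<Rightarrow> 'b \<Rightarrow> bool) \<Rightarrow> 'b set \<Rightarrow> 'b set" where
  "maximal_elements le I = {x \<in> I. \<forall>y\<in>I. le x y \<longrightarrow> y = x}"

text \<open>A hyperplane determines its pair of positions, so \<^const>\<open>Phi_le\<close> is the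
  order on pairs of positions, transported to hyperplanes.\<close>

lemma diff_hyperplane_1_inject:
  fixes i j k l :: "'n::finite"
  assumes "i \<noteq> j" "k \<noteq> l" and eq: "diff_hyperplane i j 1 = diff_hyperplane k l 1"
  shows "i = k \<and> j = l"
proof -
  have "axis i 1 \<in> diff_hyperplane i j 1" "- axis j 1 \<in> diff_hyperplane i j 1"
    using assms(1) by (auto simp: diff_hyperplane_def axis_def)
  then show ?thesis
    unfolding eq using assms(2) by (auto simp: diff_hyperplane_def axis_def split: if_splits)
qed

lemma Phi_le_iff:
  assumes "inj w" "i < j" "i' < j'"
  shows "Phi_le w (pos_hyperplane w i' j') (pos_hyperplane w i j) \<longleftrightarrow> i \<le> i' \<and> j' \<le> j"
proof
  assume "Phi_le w (pos_hyperplane w i' j') (pos_hyperplane w i j)"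
  then obtain k' l' k l where
    h: "pos_hyperplane w i' j' = pos_hyperplane w k' l'" "pos_hyperplane w i j = pos_hyperplane w k l"
      "k \<le> k'" "k' < l'" "l' \<le> l"
    unfolding Phi_le_def by blast
  have ne: "w i' \<noteq> w j'" "w k' \<noteq> w l'" "w i \<noteq> w j" "w k \<noteq> w l"
    using assms h by (auto dest: injD)
  have "w i' = w k' \<and> w j' = w l'" "w i = w k \<and> w j = w l"
    using h(1,2) ne by (auto simp: pos_hyperplane_def dest: diff_hyperplane_1_inject)
  then show "i \<le> i' \<and> j' \<le> j"
    using h assms(1) by (simp add: inj_eq)
next
  assume "i \<le> i' \<and> j' \<le> j"
  then show "Phi_le w (pos_hyperplane w i' j') (pos_hyperplane w i j)"
    unfolding Phi_le_def using assms by blast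
qed

end

theory Submission
  imports Defs
begin

text \<open>Writing \<open>y\<^sub>i = x\<^sub>w\<^sub>(\<^sub>i\<^sub>)\<close>, the regions inside the cone are the nonempty sets cut out by
  prescribing, for every hyperplane of \<open>\<Phi>\<^sup>+(G, w)\<close>, whether \<open>y\<^sub>i - y\<^sub>j < 1\<close> or \<open>y\<^sub>i - y\<^sub>j > 1\<close>.
  As \<open>y\<close> decreases, the set of hyperplanes with \<open>< 1\<close> is an ideal. Conversely, every ideal is
  realised: extend it to an ideal of all pairs of positions and choose the coordinates one after
  the other; the ideal property says precisely that each new coordinate has a nonempty open
  interval to live in. If \<open>H\<close> is maximal in the ideal \<open>I\<close> then \<open>I - {H}\<close> is an ideal too, and a
  segment joining the two regions meets \<open>H\<close> in a point strictly on the correct side of all other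
  hyperplanes, so \<open>H\<close> is a wall. If \<open>H < K\<close> in \<open>I\<close>, then the part of the closed region on \<open>H\<close>
  also lies on \<open>K\<close>, so \<open>H\<close> is not a wall.\<close>

section \<open>Real representations of ideals of pairs\<close>

lemma finite_sets_separated:
  fixes L U :: "'a::{dense_linorder,no_top,no_bot} set"
  assumes "finite L" "finite U" and less: "\<And>l u. l \<in> L \<Longrightarrow> u \<in> U \<Longrightarrow> l < u"
  shows "\<exists>v. (\<forall>l\<in>L. l < v) \<and> (\<forall>u\<in>U. v < u)"
proof (cases "L = {} \<or> U = {}")
  case True
  show ?thesis
  proof (cases "L = {}")
    case True
    show ?thesis
    proof (cases "U = {}")
      case False
      obtain v where "v < Min U" using lt_ex by blast
      then show ?thesis using True False assms by auto
    qed (use True in auto)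
  next
    case False
    obtain v where "Max L < v" using gt_ex by blast
    then show ?thesis using False True assms by auto
  qed
next
  case False
  then have "Max L < Min U" using assms by auto
  then obtain v where "Max L < v" "v < Min U" using dense by blast
  then show ?thesis using False assms by auto
qed

text \<open>Induction adds a new maximum \<open>b\<close>. Its value must exceed the members of
  \<open>L\<close> and stay below those of \<open>U\<close>; closure of \<open>J\<close> under
  nested pairs makes every lower bound smaller than every upper bound.\<close>

lemma semiorder_unit_representation:
  fixes J :: "'a::linorder \<Rightarrow> 'a \<Rightarrow> bool"
  assumes "finite A"
    and J: "\<And>i i' j' j. J i j \<Longrightarrow> i \<le> i' \<Longrightarrow> i' < j' \<Longrightarrow> j' \<le> j \<Longrightarrow> J i' j'"
  shows "\<exists>t :: 'a \<Rightarrow> real. \<forall>i\<in>A. \<forall>j\<in>A. i < j \<longrightarrow>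
    t i < t j \<and> (if J i j then t j - t i < 1 else t j - t i > 1)"
  using assms(1)
proof (induction A rule: finite_linorder_max_induct)
  case empty
  then show ?case by simp
next
  case (insert b A)
  then obtain t :: "'a \<Rightarrow> real" where
    t: "\<And>i j. i \<in> A \<Longrightarrow> j \<in> A \<Longrightarrow> i < j \<Longrightarrow>
      t i < t j \<and> (if J i j then t j - t i < 1 else t j - t i > 1)"
    by blast
  define L where "L = t ` A \<union> (\<lambda>i. t i + 1) ` {i \<in> A. \<not> J i b}"
  define U where "U = (\<lambda>i. t i + 1) ` {i \<in> A. J i b}"
  have "\<exists>v. (\<forall>l\<in>L. l < v) \<and> (\<forall>u\<in>U. v < u)"
  proof (rule finite_sets_separated)
    show "finite L" "finite U" using insert(1) by (auto simp: L_def U_def)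
    fix l u assume "l \<in> L" "u \<in> U"
    then obtain k where k: "k \<in> A" "J k b" "u = t k + 1" by (auto simp: U_def)
    have "k < b" using k insert by auto
    from \<open>l \<in> L\<close> consider i where "i \<in> A" "l = t i" | i where "i \<in> A" "\<not> J i b" "l = t i + 1"
      by (auto simp: L_def)
    then show "l < u"
    proof cases
      case 1
      \<comment> \<open>If \<open>k < i\<close>, the pair \<open>(k, i)\<close> is nested in
        \<open>(k, b)\<close>, so \<open>t i - t k < 1\<close>; otherwise
        \<open>t i \<le> t k\<close> already.\<close>
      have "J k i" if "k < i" using J[OF k(2), of k i] that insert(2) 1 by auto
      with t[of i k] t[of k i] 1 k show ?thesis
        by (cases i k rule: linorder_cases) auto
    next
      case 2
      \<comment> \<open>Otherwise \<open>(i, b)\<close> would be nested in \<open>(k, b)\<close> and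
        inherit \<open>J\<close>.\<close>
      have "i < k" using J[OF k(2), of i b] insert(2) 2 by (meson not_le order_refl)
      with t[of i k] 2 k show ?thesis by auto
    qed
  qed
  then obtain v where v: "\<And>l. l \<in> L \<Longrightarrow> l < v" "\<And>u. u \<in> U \<Longrightarrow> v < u" by blast
  have "t i < v \<and> (if J i b then v - t i < 1 else v - t i > 1)" if "i \<in> A" for i
    using v(1)[of "t i"] v(1)[of "t i + 1"] v(2)[of "t i + 1"] that by (auto simp: L_def U_def)
  then have "\<forall>i\<in>insert b A. \<forall>j\<in>insert b A. i < j \<longrightarrow>
    (t(b := v)) i < (t(b := v)) j \<and>
    (if J i j then (t(b := v)) j - (t(b := v)) i < 1 else (t(b := v)) j - (t(b := v)) i > 1)"
    using t insert(2) by (auto dest: less_asym)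
  then show ?case by blast
qed

section \<open>Difference hyperplanes and their sides\<close>

lemma inner_axis_diff:
  fixes x :: "real^'n::finite"
  shows "(axis p 1 - axis q 1) \<bullet> x = x $ p - x $ q"
  by (simp add: inner_diff_left inner_axis')

lemma axis_diff_nonzero: "p \<noteq> q \<Longrightarrow> axis p 1 - axis q 1 \<noteq> (0 :: real^'n::finite)"
  by (auto simp: axis_eq_axis)

lemma diff_hyperplane_eq_inner:
  "diff_hyperplane p q c = {x. (axis p 1 - axis q 1) \<bullet> x = c}"
  by (simp add: diff_hyperplane_def inner_axis_diff)

text \<open>The points \<open>axis p 1\<close> and \<open>- axis q 1\<close> of the first hyperplane
  already pin down \<open>r\<close> and \<open>s\<close>.\<close>

lemma diff_hyperplane_1_subset_inject:
  assumes "p \<noteq> q" and sub: "diff_hyperplane p q 1 \<subseteq> diff_hyperplane r s 1"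
  shows "p = r \<and> q = s"
proof -
  have "axis p 1 \<in> diff_hyperplane r s 1" "- axis q 1 \<in> diff_hyperplane r s 1"
    by (rule subsetD[OF sub], use assms(1) in \<open>simp add: diff_hyperplane_def axis_def\<close>)+
  then show ?thesis by (auto simp: diff_hyperplane_def axis_def split: if_splits)
qed

lemma lies_above_diff_hyperplane:
  assumes "p \<noteq> q"
  shows "lies_above (diff_hyperplane p q 1) R \<longleftrightarrow> (\<forall>x\<in>R. x $ p - x $ q < 1)"
proof
  assume "lies_above (diff_hyperplane p q 1) R"
  then obtain a b where ab: "diff_hyperplane p q 1 = {x. a \<bullet> x = b}" "0 < b" "R \<subseteq> {x. a \<bullet> x < b}"
    unfolding lies_above_def open_halfspaces_def by auto
  show "\<forall>x\<in>R. x $ p - x $ q < 1"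
  proof (rule ballI, rule ccontr)
    fix x assume "x \<in> R" and "\<not> x $ p - x $ q < 1"
    then have ge: "x $ p - x $ q \<ge> 1" by simp
    \<comment> \<open>Scaling \<open>x\<close> onto the hyperplane computes
      \<open>a \<bullet> x\<close> for an arbitrary normal \<open>a\<close>: it is \<open>b\<close>
      times the difference, hence at least \<open>b\<close>.\<close>
    have "(1 / (x $ p - x $ q)) *\<^sub>R x \<in> diff_hyperplane p q 1"
      using ge by (simp add: diff_hyperplane_def flip: diff_divide_distrib)
    then have "a \<bullet> x = b * (x $ p - x $ q)"
      unfolding ab(1) using ge by (auto simp: field_simps)
    moreover have "b * (x $ p - x $ q) \<ge> b" using ge ab(2) by simp
    ultimately show False using ab(3) \<open>x \<in> R\<close> by auto
  qed
next
  assume R: "\<forall>x\<in>R. x $ p - x $ q < 1"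
  have "{x. (axis p 1 - axis q 1) \<bullet> x < 1} \<in> open_halfspaces (diff_hyperplane p q 1)"
    unfolding open_halfspaces_def diff_hyperplane_eq_inner using axis_diff_nonzero[OF assms] by blast
  then show "lies_above (diff_hyperplane p q 1) R"
    unfolding lies_above_def using R
    by (intro conjI bexI) (auto simp: inner_axis_diff diff_hyperplane_def)
qed

lemma connected_avoids_diff_hyperplane:
  assumes "connected S" "S \<inter> diff_hyperplane p q c = {}" "x \<in> S" "y \<in> S" "x $ p - x $ q < c"
  shows "y $ p - y $ q < c"
proof (rule ccontr)
  assume "\<not> y $ p - y $ q < c"
  then obtain z where "z \<in> S" "(axis p 1 - axis q 1) \<bullet> z = c"
    using connected_ivt_hyperplane[OF assms(1,3,4), of "axis p 1 - axis q 1" c] assms(5)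
    by (auto simp: inner_axis_diff)
  then show False using assms(2) by (auto simp: diff_hyperplane_eq_inner)
qed

section \<open>Cells of the cone and regions\<close>

definition Phi_pair :: "'n set set \<Rightarrow> ('n \<Rightarrow> 'n) \<Rightarrow> 'n::linorder \<Rightarrow> 'n \<Rightarrow> bool" where
  "Phi_pair G w i j \<longleftrightarrow> i < j \<and> w i < w j \<and> {w i, w j} \<in> G"

text \<open>The candidate inverse of the bijection; for a subset \<open>I\<close> of
  \<open>Phi_plus G w\<close> that is not an ideal it is empty.\<close>

definition shi_cell ::
    "'n set set \<Rightarrow> ('n \<Rightarrow> 'n) \<Rightarrow> (real^'n::{finite,linorder}) set set \<Rightarrow> (real^'n::{finite,linorder}) set" where
  "shi_cell G w I = {x \<in> perm_cone w. \<forall>i j. Phi_pair G w i j \<longrightarrow>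
     (if pos_hyperplane w i j \<in> I then x $ w i - x $ w j < 1 else x $ w i - x $ w j > 1)}"

lemma Phi_plus_alt: "Phi_plus G w = {pos_hyperplane w i j | i j. Phi_pair G w i j}"
  by (simp add: Phi_plus_def Phi_pair_def)

lemma perm_coneD: "x \<in> perm_cone w \<Longrightarrow> i < j \<Longrightarrow> x $ w j < x $ w i"
  by (simp add: perm_cone_def)

lemma perm_cone_mono: "x \<in> perm_cone w \<Longrightarrow> i \<le> j \<Longrightarrow> x $ w j \<le> x $ w i"
  by (cases "i = j") (auto dest: perm_coneD[of x w i j])

lemma pos_hyperplane_inject:
  assumes "inj w" "i < j" "k < l" "pos_hyperplane w i j = pos_hyperplane w k l"
  shows "i = k \<and> j = l"
  using diff_hyperplane_1_inject[of "w i" "w j" "w k" "w l"] assms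
  by (auto simp: pos_hyperplane_def inj_eq)

text \<open>Finite intersections of open half-spaces are convex and open; the same device serves for
  the cells.\<close>

lemma perm_cone_eq_INT:
  "perm_cone w = (\<Inter>i. \<Inter>j\<in>{i<..}. {x. (axis (w i) 1 - axis (w j) 1) \<bullet> x > 0})"
  by (auto simp: perm_cone_def inner_axis_diff)

lemma convex_perm_cone: "convex (perm_cone w)"
  unfolding perm_cone_eq_INT by (intro convex_INT convex_halfspace_gt)

lemma open_perm_cone: "open (perm_cone w)"
  unfolding perm_cone_eq_INT by (intro open_INT ballI finite open_halfspace_gt)

lemma shi_cell_eq_Int:
  "shi_cell G w I = perm_cone w \<inter> (\<Inter>i. \<Inter>j\<in>{j. Phi_pair G w i j}.
     if pos_hyperplane w i j \<in> I then {x. (axis (w i) 1 - axis (w j) 1) \<bullet> x < 1}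
     else {x. (axis (w i) 1 - axis (w j) 1) \<bullet> x > 1})"
  by (auto simp: shi_cell_def inner_axis_diff split: if_splits)

lemma convex_shi_cell: "convex (shi_cell G w I)"
  unfolding shi_cell_eq_Int
  by (intro convex_Int convex_perm_cone convex_INT)
    (simp_all add: convex_halfspace_lt convex_halfspace_gt)

lemma open_shi_cell: "open (shi_cell G w I)"
  unfolding shi_cell_eq_Int
  by (intro open_Int open_perm_cone open_INT ballI finite)
    (simp add: open_halfspace_lt open_halfspace_gt)

text \<open>For positions \<open>i < j\<close>, strict decrease excludes level 0, and the cell
  condition excludes level 1 because the pair is a \<open>Phi_pair\<close>. For \<open>j < i\<close>
  the difference is negative, so neither level is attained.\<close>

lemma shi_cell_avoids_Shi:
  assumes "w permutes UNIV"
  shows "shi_cell G w I \<subseteq> - \<Union>(Shi G)"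
proof
  fix x assume x: "x \<in> shi_cell G w I"
  then have cone: "x \<in> perm_cone w" by (simp add: shi_cell_def)
  show "x \<in> - \<Union>(Shi G)"
  proof
    assume "x \<in> \<Union>(Shi G)"
    then obtain p q where pq: "p < q" and
      eq: "x $ p - x $ q = 0 \<or> {p, q} \<in> G \<and> x $ p - x $ q = 1"
      by (auto simp: Shi_def diff_hyperplane_def)
    obtain i j where ij: "p = w i" "q = w j"
      using assms by (metis permutes_surj surjD)
    show False
    proof (cases i j rule: linorder_cases)
      case less
      then have "x $ p - x $ q \<noteq> 0" using perm_coneD[OF cone less] ij by simp
      with eq have "Phi_pair G w i j" "x $ p - x $ q = 1"
        using less pq ij by (auto simp: Phi_pair_def)
      then show False using x ij by (force simp: shi_cell_def split: if_splits)
    next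
      case greater
      then show False using perm_coneD[OF cone greater] ij eq by auto
    qed (use pq ij in auto)
  qed
qed

text \<open>The cell is connected and avoids the arrangement, so it lies in the component it meets;
  conversely no defining inequality can change its truth value along the connected set
  \<open>R\<close>.\<close>

lemma shi_cell_eq_component:
  assumes w: "w permutes UNIV" and R: "R \<in> regions (Shi G)" and x: "x \<in> R" "x \<in> shi_cell G w I"
  shows "R = shi_cell G w I"
proof
  have conn: "connected R" and avoid: "R \<inter> \<Union>(Shi G) = {}"
    using R in_components_connected in_components_subset unfolding regions_def by blast+
  show "shi_cell G w I \<subseteq> R"
    using R x components_maximal[OF _ convex_connected[OF convex_shi_cell] shi_cell_avoids_Shi[OF w]]
    unfolding regions_def by blast
  show "R \<subseteq> shi_cell G w I"
  proof
    fix y assume y: "y \<in> R"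
    have "y $ w j < y $ w i" if "i < j" for i j
    proof -
      \<comment> \<open>\<open>Shi\<close> lists each level-0 hyperplane with the smaller index
        first, but swapping the two indices does not change the hyperplane.\<close>
      have "w i \<noteq> w j" using that permutes_inj[OF w] by (auto dest: injD)
      then consider "w i < w j" | "w j < w i" by fastforce
      then have "diff_hyperplane (w i) (w j) 0 \<in> Shi G \<or> diff_hyperplane (w j) (w i) 0 \<in> Shi G"
        unfolding Shi_def by cases blast+
      moreover have "diff_hyperplane (w i) (w j) 0 = diff_hyperplane (w j) (w i) 0"
        by (auto simp: diff_hyperplane_def)
      ultimately have "R \<inter> diff_hyperplane (w j) (w i) 0 = {}" using avoid by auto
      from connected_avoids_diff_hyperplane[OF conn this x(1) y]
      show ?thesis using x(2) that by (auto simp: shi_cell_def perm_cone_def)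
    qed
    moreover have "if pos_hyperplane w i j \<in> I then y $ w i - y $ w j < 1 else y $ w i - y $ w j > 1"
      if "Phi_pair G w i j" for i j
    proof -
      have "diff_hyperplane (w i) (w j) 1 \<in> Shi G"
        using that unfolding Shi_def Phi_pair_def by blast
      then have disj: "R \<inter> diff_hyperplane (w i) (w j) 1 = {}" using avoid by auto
      \<comment> \<open>A difference below 1 passes between \<open>x\<close> and \<open>y\<close> in
        both directions; as 1 itself is not attained, a difference above 1 passes too.\<close>
      then have "y $ w i - y $ w j \<noteq> 1" using y by (auto simp: diff_hyperplane_def)
      then show ?thesis
        using connected_avoids_diff_hyperplane[OF conn disj x(1) y]
          connected_avoids_diff_hyperplane[OF conn disj y x(1)] x(2) that
        by (force simp: shi_cell_def split: if_splits)
    qed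
    ultimately show "y \<in> shi_cell G w I" by (auto simp: shi_cell_def perm_cone_def)
  qed
qed

lemma shi_cell_in_regions:
  assumes "w permutes UNIV" "shi_cell G w I \<noteq> {}"
  shows "shi_cell G w I \<in> regions (Shi G)"
proof -
  obtain x where x: "x \<in> shi_cell G w I" using assms by blast
  then have "x \<in> \<Union>(regions (Shi G))"
    using shi_cell_avoids_Shi[OF assms(1), of G I] unfolding regions_def by auto
  then obtain R where "R \<in> regions (Shi G)" "x \<in> R" by blast
  then show ?thesis using shi_cell_eq_component[OF assms(1) _ _ x] by metis
qed

lemma region_eq_shi_cell:
  assumes w: "w permutes UNIV" and R: "R \<in> regions (Shi G)" "R \<subseteq> perm_cone w"
  obtains I where "I \<subseteq> Phi_plus G w" "R = shi_cell G w I" "shi_cell G w I \<noteq> {}"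
proof -
  obtain x where x: "x \<in> R" using R in_components_nonempty unfolding regions_def by blast
  then have avoid: "x \<notin> \<Union>(Shi G)" using R in_components_subset unfolding regions_def by blast
  define I where "I = {pos_hyperplane w i j | i j. Phi_pair G w i j \<and> x $ w i - x $ w j < 1}"
  have "if pos_hyperplane w i j \<in> I then x $ w i - x $ w j < 1 else x $ w i - x $ w j > 1"
    if "Phi_pair G w i j" for i j
  proof -
    have "diff_hyperplane (w i) (w j) 1 \<in> Shi G"
      using that unfolding Shi_def Phi_pair_def by blast
    then have "x $ w i - x $ w j \<noteq> 1" using avoid by (auto simp: diff_hyperplane_def)
    then have "x $ w i - x $ w j > 1" if "\<not> x $ w i - x $ w j < 1" using that by simp
    \<comment> \<open>Distinct pairs give distinct hyperplanes, so \<open>I\<close> records the sign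
      of each pair faithfully.\<close>
    moreover have "pos_hyperplane w i j \<in> I \<longleftrightarrow> x $ w i - x $ w j < 1"
      unfolding I_def using that pos_hyperplane_inject[OF permutes_inj[OF w]]
      by (auto simp: Phi_pair_def)
    ultimately show ?thesis by auto
  qed
  then have "x \<in> shi_cell G w I" using x R by (auto simp: shi_cell_def)
  moreover have "I \<subseteq> Phi_plus G w" by (auto simp: I_def Phi_plus_alt)
  ultimately show thesis using that shi_cell_eq_component[OF w R(1) x] by blast
qed

text \<open>For pairs outside \<open>I\<close> all differences on the cell exceed 1; since the cell
  has a point, such a hyperplane is not above it even vacuously.\<close>

lemma hyperplanes_above_shi_cell:
  assumes w: "w permutes UNIV" and I: "I \<subseteq> Phi_plus G w" and ne: "shi_cell G w I \<noteq> {}"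
  shows "{H \<in> Phi_plus G w. lies_above H (shi_cell G w I)} = I"
proof -
  have "lies_above (pos_hyperplane w i j) (shi_cell G w I) \<longleftrightarrow> pos_hyperplane w i j \<in> I"
    if "Phi_pair G w i j" for i j
  proof -
    have "w i \<noteq> w j" using that by (auto simp: Phi_pair_def)
    then have above: "lies_above (pos_hyperplane w i j) R \<longleftrightarrow> (\<forall>x\<in>R. x $ w i - x $ w j < 1)" for R
      unfolding pos_hyperplane_def by (rule lies_above_diff_hyperplane)
    have "if pos_hyperplane w i j \<in> I then x $ w i - x $ w j < 1 else x $ w i - x $ w j > 1"
      if "x \<in> shi_cell G w I" for x
      using that \<open>Phi_pair G w i j\<close> by (simp add: shi_cell_def)
    then show ?thesis unfolding above using ne by (metis ex_in_conv less_asym)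
  qed
  then show ?thesis using I by (auto simp: Phi_plus_alt)
qed

section \<open>Order ideals and nonempty cells\<close>

text \<open>Coordinates decrease along positions, so a nested pair has no larger difference, and the
  bound \<open>< 1\<close> passes down the order.\<close>

lemma nonempty_shi_cell_imp_order_ideal:
  assumes w: "w permutes UNIV" and I: "I \<subseteq> Phi_plus G w" and x: "x \<in> shi_cell G w I"
  shows "I \<in> order_ideals (Phi_plus G w) (Phi_le w)"
  unfolding order_ideals_def
proof (intro CollectI conjI ballI impI)
  fix H K assume H: "H \<in> I" and K: "K \<in> Phi_plus G w" and le: "Phi_le w K H"
  obtain i j where ij: "H = pos_hyperplane w i j" "Phi_pair G w i j"
    using H I by (auto simp: Phi_plus_alt)
  obtain k l where kl: "K = pos_hyperplane w k l" "Phi_pair G w k l"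
    using K by (auto simp: Phi_plus_alt)
  have "i \<le> k" "l \<le> j"
    using le ij kl Phi_le_iff[OF permutes_inj[OF w]] by (auto simp: Phi_pair_def)
  moreover have "x \<in> perm_cone w" using x by (simp add: shi_cell_def)
  ultimately have "x $ w k \<le> x $ w i" "x $ w j \<le> x $ w l" by (auto intro: perm_cone_mono)
  moreover have "x $ w i - x $ w j < 1" using x H ij by (auto simp: shi_cell_def)
  ultimately have "x $ w k - x $ w l < 1" by linarith
  then show "K \<in> I" using x kl by (force simp: shi_cell_def split: if_splits)
qed (fact I)

lemma order_ideal_imp_shi_cell_nonempty:
  fixes w :: "'n::{finite,linorder} \<Rightarrow> 'n"
  assumes w: "w permutes UNIV" and I: "I \<in> order_ideals (Phi_plus G w) (Phi_le w)"
  shows "shi_cell G w I \<noteq> {}"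
proof -
  \<comment> \<open>\<open>J\<close> extends the ideal to all pairs nested in a pair of
    \<open>I\<close>, as the representation needs. On pairs of \<open>Phi_pair\<close> this adds
    nothing, because \<open>I\<close> is down-closed.\<close>
  define J where "J i j \<longleftrightarrow> (\<exists>a b. Phi_pair G w a b \<and> pos_hyperplane w a b \<in> I \<and> a \<le> i \<and> j \<le> b)"
    for i j
  have "J i' j'" if "J i j" "i \<le> i'" "i' < j'" "j' \<le> j" for i i' j' j
    using that unfolding J_def by (meson order_trans)
  then obtain t :: "'n \<Rightarrow> real" where
    t: "\<And>i j. i < j \<Longrightarrow> t i < t j \<and> (if J i j then t j - t i < 1 else t j - t i > 1)"
    using semiorder_unit_representation[of UNIV J] by auto
  have J_iff: "J i j \<longleftrightarrow> pos_hyperplane w i j \<in> I" if "Phi_pair G w i j" for i j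
  proof
    assume "J i j"
    then obtain a b where ab: "Phi_pair G w a b" "pos_hyperplane w a b \<in> I" "a \<le> i" "j \<le> b"
      unfolding J_def by blast
    then have "Phi_le w (pos_hyperplane w i j) (pos_hyperplane w a b)"
      using Phi_le_iff[OF permutes_inj[OF w]] that by (auto simp: Phi_pair_def)
    then show "pos_hyperplane w i j \<in> I"
      using I ab that unfolding order_ideals_def Phi_plus_alt by blast
  qed (use that in \<open>auto simp: J_def\<close>)
  \<comment> \<open>\<open>inv w\<close> turns values into positions; the sign is reversed because
    \<open>t\<close> increases while the coordinates must decrease.\<close>
  define x where "x = (\<chi> p. - t (inv w p))"
  have x: "x $ w i = - t i" for i using permutes_inj[OF w] by (simp add: x_def)
  have "x \<in> shi_cell G w I"
    using t J_iff by (auto simp: shi_cell_def perm_cone_def x Phi_pair_def)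
  then show ?thesis by blast
qed

text \<open>Scaling a cone point by a positive factor brings the difference of a pair
  \<open>i < j\<close> to 1; conversely a positive difference at a cone point forces
  \<open>i < j\<close>.\<close>

lemma Phi_plus_eq_Shi_meeting_perm_cone:
  assumes w: "w permutes UNIV"
  shows "Phi_plus G w = {H \<in> Shi G. 0 \<notin> H \<and> H \<inter> perm_cone w \<noteq> {}}"
proof (intro equalityI subsetI)
  fix H assume "H \<in> Phi_plus G w"
  then obtain i j where ij: "H = diff_hyperplane (w i) (w j) 1" "Phi_pair G w i j"
    by (auto simp: Phi_plus_alt pos_hyperplane_def)
  \<comment> \<open>The empty ideal serves only to supply a point of the cone.\<close>
  have "{} \<in> order_ideals (Phi_plus G w) (Phi_le w)" by (simp add: order_ideals_def)
  from order_ideal_imp_shi_cell_nonempty[OF w this] obtain x where "x \<in> perm_cone w"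
    by (auto simp: shi_cell_def)
  moreover have "x $ w i - x $ w j > 0"
    using perm_coneD[OF calculation, of i j] ij by (auto simp: Phi_pair_def)
  ultimately have "(1 / (x $ w i - x $ w j)) *\<^sub>R x \<in> H \<inter> perm_cone w"
    by (auto simp: ij diff_hyperplane_def perm_cone_def divide_strict_right_mono
        simp flip: diff_divide_distrib)
  moreover have "0 \<notin> H" by (simp add: ij diff_hyperplane_def)
  moreover have "H \<in> Shi G" using ij unfolding Shi_def Phi_pair_def by blast
  ultimately show "H \<in> {H \<in> Shi G. 0 \<notin> H \<and> H \<inter> perm_cone w \<noteq> {}}" by blast
next
  fix H assume "H \<in> {H \<in> Shi G. 0 \<notin> H \<and> H \<inter> perm_cone w \<noteq> {}}"
  then obtain p q x where pq: "H = diff_hyperplane p q 1" "p < q" "{p, q} \<in> G"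
    and x: "x $ p - x $ q = 1" "x \<in> perm_cone w"
    by (auto simp: Shi_def diff_hyperplane_def)
  obtain i j where ij: "p = w i" "q = w j"
    using w by (metis permutes_surj surjD)
  have "i < j"
    using x perm_cone_mono[of x w j i] ij by (cases "i < j") (simp_all add: not_less)
  then show "H \<in> Phi_plus G w"
    using pq ij by (auto simp: Phi_plus_alt Phi_pair_def pos_hyperplane_def)
qed

section \<open>Ceilings and maximal elements\<close>

text \<open>Each weak inequality defines a closed half-space containing the cell. These bounds are
  what is available on a facet.\<close>

lemma closure_shi_cell_weak:
  assumes "x \<in> closure (shi_cell G w I)"
  shows "i \<le> j \<Longrightarrow> x $ w j \<le> x $ w i"
    and "Phi_pair G w i j \<Longrightarrow> pos_hyperplane w i j \<in> I \<Longrightarrow> x $ w i - x $ w j \<le> 1"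
proof -
  show "x $ w j \<le> x $ w i" if "i \<le> j"
  proof -
    have "shi_cell G w I \<subseteq> {x. (axis (w j) 1 - axis (w i) 1) \<bullet> x \<le> 0}"
      using that by (auto simp: inner_axis_diff shi_cell_def perm_cone_mono)
    from subsetD[OF closure_minimal[OF this closed_halfspace_le] assms]
    show ?thesis by (simp add: inner_axis_diff)
  qed
  show "x $ w i - x $ w j \<le> 1" if "Phi_pair G w i j" "pos_hyperplane w i j \<in> I"
  proof -
    have "shi_cell G w I \<subseteq> {x. (axis (w i) 1 - axis (w j) 1) \<bullet> x \<le> 1}"
      using that by (force simp: inner_axis_diff shi_cell_def)
    from subsetD[OF closure_minimal[OF this closed_halfspace_le] assms]
    show ?thesis by (simp add: inner_axis_diff)
  qed
qed

lemma ceiling_imp_maximal: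
  assumes w: "w permutes UNIV" and I: "I \<subseteq> Phi_plus G w" and ne: "shi_cell G w I \<noteq> {}"
    and H: "H \<in> ceilings (Shi G) (shi_cell G w I)"
  shows "H \<in> maximal_elements (Phi_le w) I"
proof -
  from H obtain F where F: "F facet_of closure (shi_cell G w I)" "affine hull F = H"
    and HS: "H \<in> Shi G" and above: "lies_above H (shi_cell G w I)"
    by (auto simp: ceilings_def walls_def)
  have FR: "F \<subseteq> closure (shi_cell G w I)" "F \<noteq> {}"
    using F(1) by (auto simp: facet_of_def dest: face_of_imp_subset)
  have FH: "F \<subseteq> H" using F(2) hull_subset[of F affine] by simp
  obtain p q where pq: "H = diff_hyperplane p q 1" "p < q" "{p, q} \<in> G"
    using HS above by (auto simp: Shi_def lies_above_def diff_hyperplane_def)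
  obtain i j where ij: "p = w i" "q = w j"
    using w by (metis permutes_surj surjD)
  have F1: "x $ w i - x $ w j = 1" if "x \<in> F" for x
    using that FH pq ij by (auto simp: diff_hyperplane_def)
  obtain z where z: "z \<in> F" using FR by blast
  \<comment> \<open>For positions in the other order the hyperplane also lies above the cell, but
    there the difference is at most 0 on the closure, so no facet lies on it.\<close>
  have "i < j"
  proof (rule ccontr)
    assume "\<not> i < j"
    moreover have "z \<in> closure (shi_cell G w I)" using z FR by blast
    ultimately have "z $ w i \<le> z $ w j" by (simp add: closure_shi_cell_weak(1))
    then show False using F1[OF z] by simp
  qed
  then have pair: "Phi_pair G w i j" using pq ij by (auto simp: Phi_pair_def)
  have Hij: "H = pos_hyperplane w i j" using pq ij by (simp add: pos_hyperplane_def)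
  have HI: "H \<in> I"
    using hyperplanes_above_shi_cell[OF w I ne] above pair Hij by (auto simp: Phi_plus_alt)
  moreover have "K = H" if K: "K \<in> I" and le: "Phi_le w H K" for K
  proof -
    obtain k l where kl: "K = pos_hyperplane w k l" "Phi_pair G w k l"
      using K I by (auto simp: Phi_plus_alt)
    have le': "k \<le> i" "j \<le> l"
      using le kl pair Hij Phi_le_iff[OF permutes_inj[OF w]] by (auto simp: Phi_pair_def)
    \<comment> \<open>On \<open>F\<close> the pair of \<open>H\<close> has difference 1. The pair of
      \<open>K\<close> encloses it, so its difference is at least 1, and it is at most 1 because
      \<open>K\<close> is in \<open>I\<close>.\<close>
    have "F \<subseteq> K"
    proof
      fix x assume "x \<in> F"
      then have "x \<in> closure (shi_cell G w I)" using FR by blast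
      from closure_shi_cell_weak(1)[OF this le'(1)] closure_shi_cell_weak(1)[OF this le'(2)]
        closure_shi_cell_weak(2)[OF this kl(2)] F1[OF \<open>x \<in> F\<close>] K kl(1)
      show "x \<in> K" by (auto simp: pos_hyperplane_def diff_hyperplane_def)
    qed
    moreover have "affine K"
      unfolding kl(1) pos_hyperplane_def diff_hyperplane_eq_inner by (rule affine_hyperplane)
    ultimately have "H \<subseteq> K" using F(2) hull_minimal by metis
    then show "K = H"
      using diff_hyperplane_1_subset_inject[of p q "w k" "w l"] pq kl
      by (auto simp: pos_hyperplane_def)
  qed
  ultimately show ?thesis by (simp add: maximal_elements_def)
qed

lemma maximal_imp_ceiling:
  fixes w :: "'n::{finite,linorder} \<Rightarrow> 'n"
  assumes w: "w permutes UNIV" and I: "I \<in> order_ideals (Phi_plus G w) (Phi_le w)"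
    and H: "H \<in> maximal_elements (Phi_le w) I"
  shows "H \<in> ceilings (Shi G) (shi_cell G w I)"
proof -
  have IP: "I \<subseteq> Phi_plus G w" and HI: "H \<in> I"
    using I H by (auto simp: order_ideals_def maximal_elements_def)
  obtain a b where ab: "H = pos_hyperplane w a b" "Phi_pair G w a b"
    using HI IP by (auto simp: Phi_plus_alt)
  define c :: "(real, 'n) vec" where "c = axis (w a) 1 - axis (w b) 1"
  have c: "c \<bullet> x = x $ w a - x $ w b" for x by (simp add: c_def inner_axis_diff)
  have "w a \<noteq> w b" using ab(2) by (auto simp: Phi_pair_def)
  then have c0: "c \<noteq> 0" unfolding c_def by (rule axis_diff_nonzero)
  have Hc: "H = {x. c \<bullet> x = 1}"
    by (simp add: ab pos_hyperplane_def diff_hyperplane_eq_inner c_def)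
  \<comment> \<open>No other member of \<open>I\<close> lies above \<open>H\<close>, so removing
    \<open>H\<close> keeps the set down-closed.\<close>
  have I': "I - {H} \<in> order_ideals (Phi_plus G w) (Phi_le w)"
    using I H by (auto simp: order_ideals_def maximal_elements_def)
  obtain x where x: "x \<in> shi_cell G w I"
    using order_ideal_imp_shi_cell_nonempty[OF w I] by blast
  obtain y where y: "y \<in> shi_cell G w (I - {H})"
    using order_ideal_imp_shi_cell_nonempty[OF w I'] by blast
  \<comment> \<open>The cell of the arrangement with \<open>H\<close> removed: it contains both regions adjacent to \<open>H\<close>.\<close>
  define Q where "Q = shi_cell (G - {{w a, w b}}) w I"
  \<comment> \<open>Edges are unordered, but the order built into \<open>Phi_pair\<close> fixes
    which end is which; so deleting the edge drops only the condition for \<open>H\<close>.\<close>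
  have pair_ab: "i = a \<and> j = b" if "Phi_pair G w i j" "{w i, w j} = {w a, w b}" for i j
    using that ab(2) permutes_inj[OF w] by (auto simp: Phi_pair_def doubleton_eq_iff inj_eq)
  have pair_iff: "Phi_pair (G - {{w a, w b}}) w i j \<longleftrightarrow> Phi_pair G w i j \<and> \<not> (i = a \<and> j = b)" for i j
    using pair_ab by (auto simp: Phi_pair_def)
  have neq: "pos_hyperplane w i j \<noteq> H" if "Phi_pair G w i j" "\<not> (i = a \<and> j = b)" for i j
    using that ab pos_hyperplane_inject[OF permutes_inj[OF w]] by (auto simp: Phi_pair_def)
  have cell: "shi_cell G w I = Q \<inter> {x. c \<bullet> x < 1}"
    using HI ab by (auto simp: Q_def shi_cell_def pair_iff c split: if_splits)
  have xQ: "x \<in> Q" "c \<bullet> x < 1" using x cell by auto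
  have yQ: "y \<in> Q" "c \<bullet> y > 1"
    using y neq ab by (auto simp: Q_def shi_cell_def pair_iff c split: if_splits)
  have "connected Q" by (simp add: Q_def convex_shi_cell convex_connected)
  \<comment> \<open>\<open>x\<close> and \<open>y\<close> lie in the connected set \<open>Q\<close>
    on opposite sides of \<open>H\<close>.\<close>
  then obtain z where z: "z \<in> Q \<inter> H"
    using connected_ivt_hyperplane[of Q x y c 1] xQ yQ Hc by auto
  \<comment> \<open>Since \<open>Q\<close> is open, its points on \<open>H\<close> are limits of
    points of \<open>Q\<close> below \<open>H\<close>, that is, of the cell.\<close>
  have "Q \<inter> H \<subseteq> Q \<inter> closure {x. c \<bullet> x < 1}"
    using c0 by (auto simp: Hc closure_halfspace_lt)
  also have "\<dots> \<subseteq> closure (shi_cell G w I)"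
    unfolding cell by (rule open_Int_closure_subset) (simp add: Q_def open_shi_cell)
  finally have QH: "Q \<inter> H \<subseteq> closure (shi_cell G w I)" .
  define F where "F = closure (shi_cell G w I) \<inter> H"
  \<comment> \<open>The open set \<open>Q\<close> meets \<open>H\<close> at \<open>z\<close>, so it
    cuts out a part that still spans \<open>H\<close>.\<close>
  have "affine hull (H \<inter> Q) = affine hull H"
    using z by (intro affine_hull_affine_Int_open)
      (auto simp: Hc affine_hyperplane Q_def open_shi_cell)
  then have "H \<subseteq> affine hull F"
    using QH hull_mono[of "H \<inter> Q" F affine] hull_subset[of H affine] by (auto simp: F_def)
  moreover have "affine hull F \<subseteq> H"
    by (rule hull_minimal) (auto simp: F_def Hc affine_hyperplane)
  ultimately have hullF: "affine hull F = H" by simp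
  have "closure (shi_cell G w I) \<subseteq> {x. c \<bullet> x \<le> 1}"
    unfolding cell by (intro closure_minimal closed_halfspace_le) auto
  then have "F face_of closure (shi_cell G w I)"
    unfolding F_def Hc
    by (intro face_of_Int_supporting_hyperplane_le) (auto intro: convex_closure convex_shi_cell)
  moreover have "F \<noteq> {}" using z QH by (auto simp: F_def)
  \<comment> \<open>The cell is open and nonempty, hence of full dimension, while \<open>F\<close>
    spans a hyperplane.\<close>
  moreover have "aff_dim F = aff_dim (closure (shi_cell G w I)) - 1"
  proof -
    have "aff_dim F = aff_dim H" using hullF aff_dim_affine_hull by metis
    also have "\<dots> = DIM((real, 'n) vec) - 1" using c0 by (simp add: Hc)
    finally show ?thesis using aff_dim_open[OF open_shi_cell, of G w I] ex_in_conv x by fastforce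
  qed
  ultimately have "F facet_of closure (shi_cell G w I)" by (simp add: facet_of_def)
  moreover have "H \<in> Shi G"
    using HI IP Phi_plus_eq_Shi_meeting_perm_cone[OF w] by auto
  moreover have "lies_above H (shi_cell G w I)"
    using hyperplanes_above_shi_cell[OF w IP] x HI by blast
  ultimately show ?thesis using hullF by (auto simp: ceilings_def walls_def)
qed

section \<open>The correspondence between regions and ideals\<close>

theorem theorem4p1:
  fixes G :: "('n::{finite,linorder}) set set" and w :: "'n \<Rightarrow> 'n"
  assumes "G \<subseteq> {e. card e = 2}" and "w permutes UNIV"
  shows "Phi_plus G w = {H \<in> Shi G. 0 \<notin> H \<and> H \<inter> perm_cone w \<noteq> {}}
    \<and> bij_betw (\<lambda>R. {H \<in> Phi_plus G w. lies_above H R})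
        {R \<in> regions (Shi G). R \<subseteq> perm_cone w}
        (order_ideals (Phi_plus G w) (Phi_le w))
    \<and> (\<forall>R \<in> regions (Shi G). R \<subseteq> perm_cone w \<longrightarrow>
        maximal_elements (Phi_le w) {H \<in> Phi_plus G w. lies_above H R} = ceilings (Shi G) R)"
proof (intro conjI ballI impI)
  note w = assms(2)
  show "Phi_plus G w = {H \<in> Shi G. 0 \<notin> H \<and> H \<inter> perm_cone w \<noteq> {}}"
    by (rule Phi_plus_eq_Shi_meeting_perm_cone[OF w])
  \<comment> \<open>This one fact gives the range of the map, its left inverse and the reduction of
    the ceiling claim to cells.\<close>
  have region: "\<exists>I \<in> order_ideals (Phi_plus G w) (Phi_le w). I \<subseteq> Phi_plus G w \<and>
      R = shi_cell G w I \<and> shi_cell G w I \<noteq> {} \<and> {H \<in> Phi_plus G w. lies_above H R} = I"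
    if "R \<in> regions (Shi G)" "R \<subseteq> perm_cone w" for R
  proof (rule region_eq_shi_cell[OF w that])
    fix I assume I: "I \<subseteq> Phi_plus G w" "R = shi_cell G w I" "shi_cell G w I \<noteq> {}"
    then obtain x where "x \<in> shi_cell G w I" by blast
    from nonempty_shi_cell_imp_order_ideal[OF w I(1) this] hyperplanes_above_shi_cell[OF w I(1,3)] I
    show ?thesis by blast
  qed
  show "bij_betw (\<lambda>R. {H \<in> Phi_plus G w. lies_above H R})
      {R \<in> regions (Shi G). R \<subseteq> perm_cone w} (order_ideals (Phi_plus G w) (Phi_le w))"
  proof (rule bij_betw_byWitness[where f' = "shi_cell G w"])
    show "\<forall>R \<in> {R \<in> regions (Shi G). R \<subseteq> perm_cone w}.
        shi_cell G w {H \<in> Phi_plus G w. lies_above H R} = R"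
      using region by force
    show "\<forall>I \<in> order_ideals (Phi_plus G w) (Phi_le w).
        {H \<in> Phi_plus G w. lies_above H (shi_cell G w I)} = I"
    proof
      fix I assume I: "I \<in> order_ideals (Phi_plus G w) (Phi_le w)"
      then have "I \<subseteq> Phi_plus G w" by (simp add: order_ideals_def)
      then show "{H \<in> Phi_plus G w. lies_above H (shi_cell G w I)} = I"
        by (rule hyperplanes_above_shi_cell[OF w _ order_ideal_imp_shi_cell_nonempty[OF w I]])
    qed
    show "(\<lambda>R. {H \<in> Phi_plus G w. lies_above H R}) ` {R \<in> regions (Shi G). R \<subseteq> perm_cone w}
        \<subseteq> order_ideals (Phi_plus G w) (Phi_le w)"
      using region by force
    show "shi_cell G w ` order_ideals (Phi_plus G w) (Phi_le w)
        \<subseteq> {R \<in> regions (Shi G). R \<subseteq> perm_cone w}"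
    proof (intro image_subsetI CollectI conjI)
      show "shi_cell G w I \<in> regions (Shi G)"
        if "I \<in> order_ideals (Phi_plus G w) (Phi_le w)" for I
        by (rule shi_cell_in_regions[OF w order_ideal_imp_shi_cell_nonempty[OF w that]])
    qed (auto simp: shi_cell_def)
  qed
  fix R assume "R \<in> regions (Shi G)" "R \<subseteq> perm_cone w"
  then obtain I where I: "I \<in> order_ideals (Phi_plus G w) (Phi_le w)" "I \<subseteq> Phi_plus G w"
    and R: "R = shi_cell G w I" "shi_cell G w I \<noteq> {}" "{H \<in> Phi_plus G w. lies_above H R} = I"
    using region by blast
  show "maximal_elements (Phi_le w) {H \<in> Phi_plus G w. lies_above H R} = ceilings (Shi G) R"
    \<comment> \<open>The set above \<open>R\<close> has to become \<open>I\<close> before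
      \<open>R\<close> itself is replaced by the cell.\<close>
    unfolding R(3) unfolding R(1)
    using ceiling_imp_maximal[OF w I(2) R(2)] maximal_imp_ceiling[OF w I(1)] by blast
qed

end
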